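(* Let $Z$ follow the Mixed Hypoexponential Gumbel distribution $MHG(k_1,\dots,k_n,\lambda)$, so that $$f_Z(t)=\sum_{i=1}^n\frac{1}{PG_i}f_{Y_i}(t),$$ where $Y_i\sim\mathrm{Gumbel}(k_i,\lambda)$, $i=1,\dots,n$, are $n$ random variables with $k_i\ne k_j$ for $i\neq j$, and $PG_i=\prod_{j=1,\,j\ne i}^n\left(1-e^{\frac{-k_i+k_j}{\lambda}}\right)$. Then the cumulative distribution function of $Z$ is $$F_Z(t)=\sum_{i=1}^n\frac{1}{PG_i}F_{Y_i}(t)=\sum_{i=1}^n\frac{1}{\prod_{j=1,\,j\neq i}^n\left(1-e^{\frac{-k_i+k_j}{\lambda}}\right)}\,e^{-e^{\frac{t-k_i}{\lambda}}}.$$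
   Context: $\mathrm{Gumbel}(k,\lambda)$, with location $k\in\mathbb{R}$ and scale $\lambda>0$, is defined as the distribution with PDF $f(t)=\frac1\lambda \exp\left(\frac{t-k}{\lambda}-e^{\frac{t-k}{\lambda}}\right)$, and its cumulative distribution function is given as $F(t)=e^{-e^{\frac{t-k}{\lambda}}}$. The Mixed Hypoexponential Gumbel distribution $MHG(k_1,\dots,k_n,\lambda)$ is the distribution with the PDF $f_Z$ displayed in the claim. $F_X$ denotes the cumulative distribution function of $X$.
   Formalization: The printed closed form e^{-e^{(t-k_i)/λ}} is P(Y_i>t), not the CDF of the given PDF (false already for n=1). Proved instead: the CDF identity with 1-e^{-e^{(t-k_i)/λ}} in the closed form, and the printed identities with F read as P(X>t). *)

theory Defs
  imports "HOL-Probability.Probability"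
begin

definition gumbel_density :: "real \<Rightarrow> real \<Rightarrow> real \<Rightarrow> real" where
  "gumbel_density k l t = 1 / l * exp ((t - k) / l - exp ((t - k) / l))"

definition PG :: "nat \<Rightarrow> (nat \<Rightarrow> real) \<Rightarrow> real \<Rightarrow> nat \<Rightarrow> real" where
  "PG n k l i = (\<Prod>j\<in>{1..n} - {i}. 1 - exp ((- k i + k j) / l))"

text \<open>The weights \<open>1 / PG n k l i\<close> alternate in sign; the mixture is nevertheless nonnegative for
  distinct locations and \<open>l > 0\<close>, being the density of \<open>l * ln S\<close> with \<open>S\<close> a sum of independent
  exponential variables with rates \<open>exp (- k i / l)\<close>.  So passing it through \<open>ennreal\<close> to state
  that a random variable has this density loses nothing.\<close>
definition mhg_density :: "nat \<Rightarrow> (nat \<Rightarrow> real) \<Rightarrow> real \<Rightarrow> real \<Rightarrow> real" where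
  "mhg_density n k l t = (\<Sum>i=1..n. 1 / PG n k l i * gumbel_density (k i) l t)"

text \<open>The density \<open>gumbel_density k l\<close> is the derivative of \<open>1 - exp (- exp ((t - k) / l))\<close>, so
  the expression \<open>exp (- exp ((t - k) / l))\<close> that accompanies it is the mass accumulated from
  above, not \<^const>\<open>cdf\<close>, which is the mass accumulated from below.\<close>
definition upper_cdf :: "real measure \<Rightarrow> real \<Rightarrow> real" where
  "upper_cdf M t = measure M {t<..}"

end

theory Submission
  imports Defs "HOL-Real_Asymp.Real_Asymp"
begin

text \<open>
  Integrating the densities is routine once \<^const>\<open>mhg_density\<close> is known to be nonnegative.  With
  \<open>a\<^sub>i = exp (- k\<^sub>i / l)\<close> and \<open>s = exp (t / l)\<close> it is a nonnegative multiple of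
  \<open>\<Sum>\<^sub>i exp (- a\<^sub>i s) / (\<Prod>\<^sub>j\<^sub>\<noteq>\<^sub>i (a\<^sub>j - a\<^sub>i))\<close>, a divided difference \<open>h\<^sub>n s\<close> of \<open>\<lambda>x. exp (- x * s)\<close> up to
  sign.  Since \<open>h\<^sub>n' + a\<^sub>n h\<^sub>n = h\<^sub>n\<^sub>-\<^sub>1\<close> and \<open>h\<^sub>n 0 = 0\<close> for \<open>n \<ge> 2\<close>, it is nonnegative by induction.
\<close>

text \<open>The divided difference of \<open>f\<close> at the nodes \<open>a i\<close>, times \<open>(- 1) ^ (card I - 1)\<close>.\<close>
definition signed_divdiff :: "'i set \<Rightarrow> ('i \<Rightarrow> real) \<Rightarrow> (real \<Rightarrow> real) \<Rightarrow> real" where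
  "signed_divdiff I a f = (\<Sum>i\<in>I. f (a i) / (\<Prod>j\<in>I - {i}. a j - a i))"

lemma prod_diff_insert:
  fixes a :: "'i \<Rightarrow> real"
  assumes "finite I" "p \<notin> I" "i \<noteq> p"
  shows "(\<Prod>j\<in>insert p I - {i}. a j - a i) = (a p - a i) * (\<Prod>j\<in>I - {i}. a j - a i)"
proof -
  have "insert p I - {i} = insert p (I - {i})" using assms by auto
  then show ?thesis using assms by simp
qed

text \<open>The classical recurrence of divided differences, its right side negated by the sign
  convention. At a common node it is \<open>1 / u - 1 / v = (v - u) / (u * v)\<close> with
  \<open>u = a p - a i\<close> and \<open>v = a q - a i\<close>; here
  \<open>v - u = a q - a p\<close> is independent of \<open>i\<close>.\<close>

lemma signed_divdiff_rec:
  assumes "finite I" "p \<notin> I" "q \<notin> I" "p \<noteq> q" "inj_on a (insert p (insert q I))"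
  shows "signed_divdiff (insert p I) a f - signed_divdiff (insert q I) a f
    = (a q - a p) * signed_divdiff (insert p (insert q I)) a f"
proof -
  have ne: "a p \<noteq> a i" "a q \<noteq> a i" if "i \<in> I" for i
    using assms that by (auto simp: inj_on_def)
  have pq: "a p \<noteq> a q" using assms by (auto simp: inj_on_def)
  have Iq: "insert q I - {q} = I" "insert p I - {p} = I" using assms by auto
  have pp: "(\<Prod>j\<in>insert p (insert q I) - {p}. a j - a p) = (a q - a p) * (\<Prod>j\<in>I. a j - a p)"
    using assms prod_diff_insert[of I q p a] by (simp add: insert_Diff_if)
  have qq: "(\<Prod>j\<in>insert p (insert q I) - {q}. a j - a q) = (a p - a q) * (\<Prod>j\<in>I. a j - a q)"
    using assms by (simp add: insert_Diff_if)
  have summand: "f (a i) / (\<Prod>j\<in>insert p I - {i}. a j - a i)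
      - f (a i) / (\<Prod>j\<in>insert q I - {i}. a j - a i)
      = (a q - a p) * (f (a i) / (\<Prod>j\<in>insert p (insert q I) - {i}. a j - a i))"
    if "i \<in> I" for i
  proof -
    have i: "i \<noteq> p" "i \<noteq> q" using that assms by auto
    \<comment> \<open>If \<open>P = 0\<close>, both sides are 0 because division by zero yields
      0.\<close>
    have split: "x / (u * P) - x / (v * P) = (v - u) * (x / (u * (v * P)))"
      if "u \<noteq> 0" "v \<noteq> 0" for x u v P :: real
      using that by (cases "P = 0") (simp_all add: field_simps)
    show ?thesis
      using split[of "a p - a i" "a q - a i"] i assms(1-4) ne[OF that]
      by (simp add: prod_diff_insert)
  qed
  \<comment> \<open>The terms at \<open>p\<close> and at \<open>q\<close> each occur in only one of
    the two smaller differences; expanding the fraction by the missing factor matches it with the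
    larger one.\<close>
  have p_term: "f (a p) / (\<Prod>j\<in>I. a j - a p)
      = (a q - a p) * (f (a p) / (\<Prod>j\<in>insert p (insert q I) - {p}. a j - a p))"
    unfolding pp using pq by simp
  have q_term: "f (a q) / (\<Prod>j\<in>I. a j - a q)
      = (a p - a q) * (f (a q) / (\<Prod>j\<in>insert p (insert q I) - {q}. a j - a q))"
    unfolding qq using pq by (simp add: divide_simps)
  have expand: "signed_divdiff (insert p (insert q I)) a f
      = f (a p) / (\<Prod>j\<in>insert p (insert q I) - {p}. a j - a p)
        + (f (a q) / (\<Prod>j\<in>insert p (insert q I) - {q}. a j - a q)
        + (\<Sum>i\<in>I. f (a i) / (\<Prod>j\<in>insert p (insert q I) - {i}. a j - a i)))"
    using assms unfolding signed_divdiff_def by simp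
  have "signed_divdiff (insert p I) a f - signed_divdiff (insert q I) a f
      = f (a p) / (\<Prod>j\<in>I. a j - a p) - f (a q) / (\<Prod>j\<in>I. a j - a q)
        + (a q - a p) * (\<Sum>i\<in>I. f (a i) / (\<Prod>j\<in>insert p (insert q I) - {i}. a j - a i))"
    using assms Iq unfolding signed_divdiff_def
    by (simp add: sum_distrib_left sum_subtractf[symmetric] summand cong: sum.cong)
  also have "\<dots> = (a q - a p) * signed_divdiff (insert p (insert q I)) a f"
    unfolding p_term q_term expand by (simp only: algebra_simps)
  finally show ?thesis .
qed

text \<open>Naming \<open>p\<close> and \<open>q\<close> expresses that there are at least two
  nodes. By \<open>signed_divdiff_rec\<close>, the value times \<open>a q - a p\<close> is a
  difference of two values with one node fewer: both are \<open>c\<close> in the base case, and both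
  are 0 by induction afterwards.\<close>

lemma signed_divdiff_const:
  assumes "finite I" "p \<notin> I" "q \<notin> I" "p \<noteq> q" "inj_on a (insert p (insert q I))"
  shows "signed_divdiff (insert p (insert q I)) a (\<lambda>_. c) = 0"
  using assms
proof (induction I arbitrary: p q rule: finite_induct)
  case empty
  then have "signed_divdiff {p} a (\<lambda>_. c) - signed_divdiff {q} a (\<lambda>_. c) = 0"
    by (simp add: signed_divdiff_def)
  then show ?case
    using signed_divdiff_rec[of "{}" p q a "\<lambda>_. c"] empty by auto
next
  case (insert r J)
  have "signed_divdiff (insert p (insert r J)) a (\<lambda>_. c) = 0"
    "signed_divdiff (insert q (insert r J)) a (\<lambda>_. c) = 0"
    by (rule insert.IH; use insert in \<open>auto simp: inj_on_def\<close>)+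
  moreover have "a q \<noteq> a p" using insert by (auto simp: inj_on_def)
  ultimately show ?case
    using signed_divdiff_rec[of "insert r J" p q a "\<lambda>_. c"] insert by auto
qed

text \<open>The sign to expect: the derivative of order \<open>m\<close> of
  \<open>exp (- x * s)\<close> in \<open>x\<close> is \<open>(- s) ^ m * exp (- x * s)\<close>, and
  \<open>signed_divdiff\<close> cancels the alternation. Since the argument integrates in
  \<open>s\<close> from 0, the induction keeps \<open>s\<close> arbitrary.\<close>

lemma signed_divdiff_exp_nonneg:
  assumes "finite I" "inj_on a I" "s \<ge> 0"
  shows "signed_divdiff I a (\<lambda>x. exp (- x * s)) \<ge> 0"
  using assms
proof (induction I arbitrary: s rule: finite_induct)
  case empty
  then show ?case by (simp add: signed_divdiff_def)
next
  case (insert p I)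
  let ?D = "\<lambda>I s. signed_divdiff I a (\<lambda>x. exp (- x * s))"
  show ?case
  proof (cases "I = {}")
    case True
    then show ?thesis by (simp add: signed_divdiff_def)
  next
    case False
    then obtain q J where J: "I = insert q J" "q \<notin> J"
      by (meson ex_in_conv mk_disjoint_insert)
    \<comment> \<open>\<open>exp (a p * s)\<close> is the integrating factor of the differential
      equation, so that only \<open>exp (a p * s) * ?D I s\<close> remains as the derivative of
      \<open>H\<close>.\<close>
    define H where "H s = exp (a p * s) * ?D (insert p I) s" for s
    have H: "H s = (\<Sum>i\<in>insert p I. exp ((a p - a i) * s) / (\<Prod>j\<in>insert p I - {i}. a j - a i))"
      for s unfolding H_def signed_divdiff_def sum_distrib_left
      by (intro sum.cong refl) (simp add: mult_exp_exp algebra_simps)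
    have deriv: "(H has_real_derivative exp (a p * s) * ?D I s) (at s)" for s
    proof -
      have "(H has_real_derivative (\<Sum>i\<in>insert p I. (a p - a i) * exp ((a p - a i) * s)
          / (\<Prod>j\<in>insert p I - {i}. a j - a i))) (at s)"
        unfolding H by (intro DERIV_sum DERIV_cdivide) (rule derivative_eq_intros refl | simp)+
      \<comment> \<open>The summand at \<open>p\<close> vanishes because of its factor
        \<open>a p - a p\<close>.\<close>
      also have "(\<Sum>i\<in>insert p I. (a p - a i) * exp ((a p - a i) * s)
          / (\<Prod>j\<in>insert p I - {i}. a j - a i))
        = (\<Sum>i\<in>I. (a p - a i) * exp ((a p - a i) * s) / (\<Prod>j\<in>insert p I - {i}. a j - a i))"
        using insert.hyps by simp
      also have "\<dots> = exp (a p * s) * ?D I s"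
        unfolding signed_divdiff_def sum_distrib_left
      proof (intro sum.cong refl)
        fix i assume i: "i \<in> I"
        then have "i \<noteq> p" "a p \<noteq> a i" using insert by (auto simp: inj_on_def)
        moreover have "exp (a p * s) * exp (- a i * s) = exp ((a p - a i) * s)"
          by (simp add: mult_exp_exp algebra_simps)
        ultimately show "(a p - a i) * exp ((a p - a i) * s) / (\<Prod>j\<in>insert p I - {i}. a j - a i)
          = exp (a p * s) * (exp (- a i * s) / (\<Prod>j\<in>I - {i}. a j - a i))"
          using insert.hyps by (simp add: prod_diff_insert)
      qed
      finally show ?thesis .
    qed
    have nonneg: "exp (a p * r) * ?D I r \<ge> 0" if "r \<ge> 0" for r
      using insert that by auto
    have "H 0 \<le> H s"
      by (rule DERIV_nonneg_imp_nondecreasing[OF insert.prems(2)]) (metis deriv nonneg)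
    \<comment> \<open>At \<open>s = 0\<close> the exponential is constantly 1, and \<open>p\<close>
      and \<open>q\<close> are two nodes.\<close>
    moreover have "H 0 = 0"
      using signed_divdiff_const[of J p q a 1] insert J by (simp add: H_def)
    ultimately show ?thesis
      by (simp add: H_def zero_le_mult_iff)
  qed
qed

lemma gumbel_density_nonneg: "l > 0 \<Longrightarrow> gumbel_density k l t \<ge> 0"
  by (simp add: gumbel_density_def)

text \<open>The weights change sign, so this cannot be read off termwise; rewriting in
  \<open>a\<close> and \<open>s\<close> turns the sum into a divided difference of
  exponentials.\<close>

lemma mhg_density_nonneg:
  assumes "l > 0" "inj_on k {1..n}"
  shows "mhg_density n k l t \<ge> 0"
proof -
  define a where "a i = exp (- k i / l)" for i
  define s where "s = exp (t / l)"
  have a: "a i > 0" for i by (simp add: a_def)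
  have inj: "inj_on a {1..n}"
    using assms(1) by (intro inj_onI inj_onD[OF assms(2)]) (simp_all add: a_def)
  have PG: "PG n k l i = (\<Prod>j\<in>{1..n} - {i}. a j - a i) / (\<Prod>j\<in>{1..n} - {i}. a j)" for i
    unfolding PG_def prod_dividef[symmetric]
  proof (intro prod.cong refl)
    fix j
    have "exp ((- k i + k j) / l) = a i / a j"
      unfolding a_def exp_diff[symmetric] by (simp add: diff_divide_distrib)
    then show "1 - exp ((- k i + k j) / l) = (a j - a i) / a j"
      using a[of j] by (simp add: diff_divide_distrib)
  qed
  have g: "gumbel_density (k i) l t = s / l * (a i * exp (- a i * s))" for i
  proof -
    have "exp ((t - k i) / l) = a i * s"
      unfolding a_def s_def mult_exp_exp by (simp add: diff_divide_distrib)
    then show ?thesis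
      by (simp add: gumbel_density_def exp_diff exp_minus divide_inverse mult_ac)
  qed
  \<comment> \<open>The factor \<open>a i\<close> of the Gumbel density completes the product over
    the other nodes to the product over all of them, so the prefactor no longer depends on
    \<open>i\<close>.\<close>
  have "1 / PG n k l i * gumbel_density (k i) l t
      = s / l * (\<Prod>j\<in>{1..n}. a j) * (exp (- a i * s) / (\<Prod>j\<in>{1..n} - {i}. a j - a i))"
    if "i \<in> {1..n}" for i
    unfolding PG g prod.remove[OF finite_atLeastAtMost that, of a] by (simp add: mult_ac)
  then have "mhg_density n k l t
      = s / l * (\<Prod>j\<in>{1..n}. a j) * signed_divdiff {1..n} a (\<lambda>x. exp (- x * s))"
    unfolding mhg_density_def signed_divdiff_def by (simp add: sum_distrib_left)
  also have "\<dots> \<ge> 0"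
    using assms a inj
    by (intro mult_nonneg_nonneg prod_nonneg signed_divdiff_exp_nonneg)
      (auto simp: s_def less_imp_le)
  finally show ?thesis .
qed

lemma gumbel_integral:
  assumes "l > 0"
  shows "has_bochner_integral lborel (\<lambda>s. gumbel_density k l s * indicator {..t} s)
      (1 - exp (- exp ((t - k) / l)))" (is ?lower)
    and "has_bochner_integral lborel (\<lambda>s. gumbel_density k l s * indicator {t<..} s)
      (exp (- exp ((t - k) / l)))" (is ?upper)
proof -
  \<comment> \<open>This antiderivative runs from -1 to 0, so the lower integral is
    \<open>F t + 1\<close> and the upper one is \<open>- F t\<close>.\<close>
  define F where "F s = - exp (- exp ((s - k) / l))" for s
  have F: "DERIV F s :> gumbel_density k l s" for s
    unfolding F_def gumbel_density_def
    by (auto intro!: derivative_eq_intros simp: exp_diff exp_minus divide_inverse mult_ac)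
  have cont: "isCont (gumbel_density k l) s" for s
    unfolding gumbel_density_def by (intro continuous_intros) (use assms in auto)
  have F_cont: "(F \<longlongrightarrow> F t) (at_left t)" "(F \<longlongrightarrow> F t) (at_right t)"
    using DERIV_isCont[OF F] by (auto simp: isCont_def filterlim_at_split)
  have bot: "(F \<longlongrightarrow> - 1) at_bot" and top: "(F \<longlongrightarrow> 0) at_top"
    unfolding F_def using assms by real_asymp+
  have meas[measurable]: "gumbel_density k l \<in> borel_measurable borel"
    unfolding gumbel_density_def by measurable
  have nonneg: "AE s in lborel. a < ereal s \<longrightarrow> ereal s < b \<longrightarrow> 0 \<le> gumbel_density k l s" for a b
    using assms by (simp add: gumbel_density_nonneg)
  note lower = interval_integral_FTC_nonneg[of "- \<infinity>" "ereal t" F "gumbel_density k l" "- 1" "F t",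
      OF _ F cont nonneg, unfolded ereal_tendsto_simps1, OF _ bot F_cont(1)]
  note upper = interval_integral_FTC_nonneg[of "ereal t" \<infinity> F "gumbel_density k l" "F t" 0,
      OF _ F cont nonneg, unfolded ereal_tendsto_simps1, OF _ F_cont(2) top]
  have "has_bochner_integral lborel (\<lambda>s. gumbel_density k l s * indicator {..<t} s)
      (1 - exp (- exp ((t - k) / l)))"
    using lower by (simp add: has_bochner_integral_iff set_integrable_def F_def
        interval_lebesgue_integral_def set_lebesgue_integral_def mult.commute)
  \<comment> \<open>The interval integral is over the open half-line; the endpoint \<open>t\<close>
    is a null set.\<close>
  moreover have "AE s in lborel. gumbel_density k l s * indicator {..<t} s
      = gumbel_density k l s * indicator {..t} s"
    using AE_lborel_singleton[of t] by eventually_elim (auto simp: indicator_def)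
  ultimately show ?lower
    by (subst (asm) has_bochner_integral_cong_AE[where g = "\<lambda>s. gumbel_density k l s * indicator {..t} s"]) auto
  show ?upper
    using upper by (simp add: has_bochner_integral_iff set_integrable_def F_def
        interval_lebesgue_integral_def set_lebesgue_integral_def mult.commute)
qed

text \<open>Both sides are the expectation of \<open>indicator A (X x)\<close>. Nonnegativity of
  \<open>f\<close> ensures that \<open>ennreal\<close> does not truncate it.\<close>

lemma measure_distr_distributed:
  fixes f :: "real \<Rightarrow> real"
  assumes "distributed M lborel X (\<lambda>s. ennreal (f s))" "\<And>s. f s \<ge> 0" "A \<in> sets borel"
    and "has_bochner_integral lborel (\<lambda>s. f s * indicator A s) m"
  shows "measure (distr M borel X) A = m"
proof -
  have X: "X \<in> measurable M borel"
    using distributed_measurable[OF assms(1)] by simp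
  have "m = (\<integral>s. f s * indicator A s \<partial>lborel)"
    using assms(4) by (simp add: has_bochner_integral_iff)
  also have "\<dots> = (\<integral>x. indicator A (X x) \<partial>M)"
    using assms by (intro distributed_integral) auto
  also have "\<dots> = measure (distr M borel X) A"
    using X assms(3) integral_distr[OF X, of "indicator A :: real \<Rightarrow> real"] by simp
  finally show ?thesis ..
qed

text \<open>Linearity of the integral. Leaving \<open>A\<close> general covers both
  \<open>{..t}\<close> and \<open>{t<..}\<close>.\<close>

lemma measure_distr_mhg:
  assumes "l > 0" "inj_on k {1..n}" "A \<in> sets borel"
    and "distributed M lborel Z (\<lambda>s. ennreal (mhg_density n k l s))"
    and "\<And>i. has_bochner_integral lborel (\<lambda>s. gumbel_density (k i) l s * indicator A s) (m i)"
  shows "measure (distr M borel Z) A = (\<Sum>i=1..n. 1 / PG n k l i * m i)"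
proof (rule measure_distr_distributed[OF assms(4) _ assms(3)])
  show "mhg_density n k l s \<ge> 0" for s
    by (rule mhg_density_nonneg[OF assms(1,2)])
  show "has_bochner_integral lborel (\<lambda>s. mhg_density n k l s * indicator A s)
      (\<Sum>i=1..n. 1 / PG n k l i * m i)"
    unfolding mhg_density_def sum_distrib_right mult.assoc
    by (intro has_bochner_integral_sum has_bochner_integral_mult_right assms(5))
qed

text \<open>The mixture identity holds for either direction of accumulation. For this density the
  closed form \<open>exp (- exp ((t - k i) / l))\<close> belongs to the upper tail, while
  \<open>cdf\<close> has its complement to 1; both versions are therefore stated.\<close>

theorem corollary6:
  fixes M :: "'a measure" and N :: "'b measure"
    and Z :: "'a \<Rightarrow> real" and Y :: "nat \<Rightarrow> 'b \<Rightarrow> real"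
    and n :: nat and k :: "nat \<Rightarrow> real" and l t :: real
  assumes "prob_space M" and "prob_space N"
    and "l > 0"
    and "\<And>i j. i \<in> {1..n} \<Longrightarrow> j \<in> {1..n} \<Longrightarrow> i \<noteq> j \<Longrightarrow> k i \<noteq> k j"
    and "\<And>i. i \<in> {1..n} \<Longrightarrow> distributed N lborel (Y i) (\<lambda>s. ennreal (gumbel_density (k i) l s))"
    and "distributed M lborel Z (\<lambda>s. ennreal (mhg_density n k l s))"
  shows "(cdf (distr M borel Z) t
           = (\<Sum>i=1..n. 1 / PG n k l i * cdf (distr N borel (Y i)) t)
        \<and> (\<Sum>i=1..n. 1 / PG n k l i * cdf (distr N borel (Y i)) t)
           = (\<Sum>i=1..n. 1 / (\<Prod>j\<in>{1..n} - {i}. 1 - exp ((- k i + k j) / l))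
                * (1 - exp (- exp ((t - k i) / l)))))
      \<and> (upper_cdf (distr M borel Z) t
           = (\<Sum>i=1..n. 1 / PG n k l i * upper_cdf (distr N borel (Y i)) t)
        \<and> (\<Sum>i=1..n. 1 / PG n k l i * upper_cdf (distr N borel (Y i)) t)
           = (\<Sum>i=1..n. 1 / (\<Prod>j\<in>{1..n} - {i}. 1 - exp ((- k i + k j) / l))
                * exp (- exp ((t - k i) / l))))"
proof -
  have inj: "inj_on k {1..n}"
    using assms(4) unfolding inj_on_def by blast
  note gumbel = gumbel_integral[OF assms(3)]
  note Y = measure_distr_distributed[OF assms(5) gumbel_density_nonneg[OF assms(3)]]
  note Z = measure_distr_mhg[OF assms(3) inj _ assms(6)]
  have "cdf (distr N borel (Y i)) t = 1 - exp (- exp ((t - k i) / l))"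
    "upper_cdf (distr N borel (Y i)) t = exp (- exp ((t - k i) / l))" if "i \<in> {1..n}" for i
    unfolding cdf_def upper_cdf_def by (rule Y[OF that _ gumbel(1)] Y[OF that _ gumbel(2)]; simp)+
  moreover have "cdf (distr M borel Z) t
      = (\<Sum>i=1..n. 1 / PG n k l i * (1 - exp (- exp ((t - k i) / l))))"
    unfolding cdf_def by (rule Z[OF _ gumbel(1)]) simp
  moreover have "upper_cdf (distr M borel Z) t
      = (\<Sum>i=1..n. 1 / PG n k l i * exp (- exp ((t - k i) / l)))"
    unfolding upper_cdf_def by (rule Z[OF _ gumbel(2)]) simp
  ultimately show ?thesis
    by (simp add: PG_def)
qed

end
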